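(* Let $G$ be a countable group with a uniformly discrete, proper, left-invariant metric $d_G$. Suppose $G$ acts co-finitely on a strongly embeddable uniformly discrete bounded geometry metric space $(X,d_X)$. Let $x_1,\ldots,x_n\in X$ be representatives of the $G$-orbits. For each $i$, let $H_i$ be the stabilizer of $x_i$ in $G$, and let $\pi_i : G\to G/H_i$ be the quotient map. Then $\{\pi_i : i=1,\ldots,n\}$ is a strongly embeddable family of maps.
   Context: A metric is uniformly discrete if distinct points are at distance at least some fixed $\delta>0$; a metric on a group is proper if every ball is finite; a metric space has bounded geometry if for every $r>0$ the cardinality of balls of radius $r$ is uniformly bounded. An action is co-finite if it has finitely many orbits. $B_S(x)$ denotes the ball of radius $S$ centered at $x$. Strong embeddability: $(X,d)$ is strongly embeddable if for every $R,\epsilon>0$ there exists a map $\beta : X \to \ell^2(X)$, $x \mapsto \beta_x$, with $\|\beta_x\|=1$ for each $x\in X$, such that: (1) if $d(x,y)\le R$ then $\|\beta_x-\beta_y\|\le\epsilon$; (2) $\lim_{S\to\infty}\sup_{x\in X}\sum_{w\notin B_S(x)}|\beta_x(w)|^2=0$. Strongly embeddable family of maps: for a metric space $(Z,d)$ and a finite family of sets $Y_1,\ldots,Y_n$, let $\mathcal{Y}=\bigsqcup_{i=1}^n Y_i$ be the disjoint union (each $Y_i$ regarded as a subset of $\mathcal{Y}$). A family of set maps $\{\phi_i : Z\to Y_i\}_{i=1}^n$ is a strongly embeddable family of maps if for every $R,\epsilon>0$ there exists a map $\xi : Z\to\ell^2(\mathcal{Y})$, $z\mapsto\xi_z$, with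 $\|\xi_z\|=1$ for all $z\in Z$, such that: (1) for all $y,z\in Z$ with $d(y,z)\le R$, $\|\xi_y-\xi_z\|\le\epsilon$; (2) $\lim_{S\to\infty}\sup_{z\in Z}\sum_{w\notin\bigcup_i\phi_i(B_S(z))}|\xi_z(w)|^2=0$. Here this is applied with $Z=G$, $d=d_G$, $Y_i=G/H_i$ and $\phi_i=\pi_i$. *)

theory Defs
  imports "HOL-Analysis.Analysis" "HOL-Algebra.Group_Action" "HOL-Algebra.Left_Coset"
begin

text \<open>Elements of \<open>\<ell>\<^sup>2(A)\<close> are represented by their extensions by zero outside \<open>A\<close>.\<close>

definition ell2 :: "'a set \<Rightarrow> ('a \<Rightarrow> complex) set" where
  "ell2 A = {f. (\<forall>w. w \<notin> A \<longrightarrow> f w = 0) \<and> (\<lambda>w. (cmod (f w))\<^sup>2) summable_on A}"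

definition ell2_norm :: "'a set \<Rightarrow> ('a \<Rightarrow> complex) \<Rightarrow> real" where
  "ell2_norm A f = sqrt (\<Sum>\<^sub>\<infinity>w\<in>A. (cmod (f w))\<^sup>2)"

context Metric_space
begin

definition uniformly_discrete :: bool where
  "uniformly_discrete \<longleftrightarrow> (\<exists>\<delta>>0. \<forall>x\<in>M. \<forall>y\<in>M. x \<noteq> y \<longrightarrow> \<delta> \<le> d x y)"

definition proper_metric :: bool where
  "proper_metric \<longleftrightarrow> (\<forall>x\<in>M. \<forall>r. finite (mcball x r))"

definition bounded_geometry :: bool where
  "bounded_geometry \<longleftrightarrow>
    (\<forall>r>0. \<exists>N::nat. \<forall>x\<in>M. finite (mcball x r) \<and> card (mcball x r) \<le> N)"

text \<open>The suprema of the tails are taken in \<open>ennreal\<close>, so that they are genuine least upper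
  bounds in all cases (including an empty index set, where the real \<open>Sup\<close> is unspecified).\<close>

definition strongly_embeddable :: bool where
  "strongly_embeddable \<longleftrightarrow>
    (\<forall>R>0. \<forall>\<epsilon>>0. \<exists>\<beta>.
      \<beta> \<in> M \<rightarrow> ell2 M \<and>
      (\<forall>x\<in>M. ell2_norm M (\<beta> x) = 1) \<and>
      (\<forall>x\<in>M. \<forall>y\<in>M. d x y \<le> R \<longrightarrow> ell2_norm M (\<lambda>w. \<beta> x w - \<beta> y w) \<le> \<epsilon>) \<and>
      ((\<lambda>S::real. SUP x\<in>M. ennreal (\<Sum>\<^sub>\<infinity>w\<in>M - mcball x S. (cmod (\<beta> x w))\<^sup>2))
        \<longlongrightarrow> 0) at_top)"

text \<open>For a family \<open>\<phi> i : M \<rightarrow> Y i\<close>, \<open>i = 1, \<dots>, n\<close>; the disjoint union of the \<open>Y i\<close> is the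
  dependent sum, with \<open>w \<in> Y i\<close> represented by \<open>(i, w)\<close>.\<close>

definition strongly_embeddable_family ::
  "nat \<Rightarrow> (nat \<Rightarrow> 'b set) \<Rightarrow> (nat \<Rightarrow> 'a \<Rightarrow> 'b) \<Rightarrow> bool" where
  "strongly_embeddable_family n Y \<phi> \<longleftrightarrow>
    (\<forall>i\<in>{1..n}. \<phi> i \<in> M \<rightarrow> Y i) \<and>
    (\<forall>R>0. \<forall>\<epsilon>>0. \<exists>\<xi>.
      \<xi> \<in> M \<rightarrow> ell2 (Sigma {1..n} Y) \<and>
      (\<forall>z\<in>M. ell2_norm (Sigma {1..n} Y) (\<xi> z) = 1) \<and>
      (\<forall>y\<in>M. \<forall>z\<in>M. d y z \<le> R \<longrightarrow>
        ell2_norm (Sigma {1..n} Y) (\<lambda>w. \<xi> y w - \<xi> z w) \<le> \<epsilon>) \<and>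
      ((\<lambda>S::real. SUP z\<in>M.
          ennreal (\<Sum>\<^sub>\<infinity>w\<in>Sigma {1..n} Y - (SIGMA i:{1..n}. \<phi> i ` mcball z S).
            (cmod (\<xi> z w))\<^sup>2))
        \<longlongrightarrow> 0) at_top)"

end

definition left_invariant :: "('g, 'm) monoid_scheme \<Rightarrow> ('g \<Rightarrow> 'g \<Rightarrow> real) \<Rightarrow> bool" where
  "left_invariant G d \<longleftrightarrow>
    (\<forall>g\<in>carrier G. \<forall>h\<in>carrier G. \<forall>k\<in>carrier G. d (g \<otimes>\<^bsub>G\<^esub> h) (g \<otimes>\<^bsub>G\<^esub> k) = d h k)"

definition isometric_action ::
  "('g, 'm) monoid_scheme \<Rightarrow> 'x set \<Rightarrow> ('x \<Rightarrow> 'x \<Rightarrow> real) \<Rightarrow> ('g \<Rightarrow> 'x \<Rightarrow> 'x) \<Rightarrow> bool" where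
  "isometric_action G X d \<phi> \<longleftrightarrow>
    group_action G X \<phi> \<and>
    (\<forall>g\<in>carrier G. \<forall>x\<in>X. \<forall>y\<in>X. d (\<phi> g x) (\<phi> g y) = d x y)"

end

theory Submission
  imports Defs
begin

text \<open>Fix a base point \<open>x\<^sub>0 \<in> X\<close>. The orbit maps identify the disjoint union of the \<open>G/H\<^sub>i\<close> with
  \<open>X\<close>, and under this identification \<open>\<xi>\<^sub>g\<close> is \<open>\<beta>\<close> at the point \<open>g x\<^sub>0\<close>. Properness of the metric
  on \<open>G\<close> makes \<open>g \<mapsto> g x\<^sub>0\<close> bornologous, which gives the first condition. For the second one, the
  ball of radius \<open>S\<close> about \<open>x\<^sub>0\<close> is finite, so its points are \<open>h x\<^sub>i\<close> with \<open>h\<close> in a ball of some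
  radius \<open>T\<close> about the identity, and translation by \<open>g\<close> transports this to \<open>g x\<^sub>0\<close>.\<close>

section \<open>Pulling back strong embeddability along a map of metric spaces\<close>

text \<open>The analytic half of the argument, free of groups: the vector at \<open>z\<close> is
  \<open>\<beta> (p z)\<close> read through the bijection \<open>f\<close>. The hypothesis
  \<open>bornologous\<close> reduces closeness at scale \<open>R\<close> to closeness in
  \<open>X\<close> at scale \<open>R'\<close>. The hypothesis \<open>cover\<close>, whose
  \<open>T\<close> is uniform in \<open>z\<close>, reduces the tails to those of
  \<open>\<beta>\<close>.\<close>

lemma strongly_embeddable_family_pullback:
  assumes M: "Metric_space M d" and X: "Metric_space X d'"
    and emb: "Metric_space.strongly_embeddable X d'"
    and \<phi>: "\<And>i. i \<in> {1..n} \<Longrightarrow> \<phi> i \<in> M \<rightarrow> Y i"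
    and f: "bij_betw f (Sigma {1..n} Y) X"
    and p: "p \<in> M \<rightarrow> X"
    and bornologous: "\<And>R. R > 0 \<Longrightarrow> \<exists>R'>0. \<forall>y\<in>M. \<forall>z\<in>M. d y z \<le> R \<longrightarrow> d' (p y) (p z) \<le> R'"
    and cover: "\<And>S. \<exists>T. \<forall>z\<in>M. \<forall>w\<in>Sigma {1..n} Y.
      f w \<in> Metric_space.mcball X d' (p z) S \<longrightarrow>
      w \<in> (SIGMA i:{1..n}. \<phi> i ` Metric_space.mcball M d z T)"
  shows "Metric_space.strongly_embeddable_family M d n Y \<phi>"
proof -
  interpret M: Metric_space M d by (rule M)
  interpret X: Metric_space X d' by (rule X)
  let ?Y = "Sigma {1..n} Y"
  have fX: "f w \<in> X" if "w \<in> ?Y" for w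
    using f that by (auto simp: bij_betw_def)
  have "\<exists>\<xi>. \<xi> \<in> M \<rightarrow> ell2 ?Y \<and> (\<forall>z\<in>M. ell2_norm ?Y (\<xi> z) = 1) \<and>
      (\<forall>y\<in>M. \<forall>z\<in>M. d y z \<le> R \<longrightarrow> ell2_norm ?Y (\<lambda>w. \<xi> y w - \<xi> z w) \<le> \<epsilon>) \<and>
      ((\<lambda>S::real. SUP z\<in>M. ennreal (\<Sum>\<^sub>\<infinity>w\<in>?Y - (SIGMA i:{1..n}. \<phi> i ` M.mcball z S).
          (cmod (\<xi> z w))\<^sup>2)) \<longlongrightarrow> 0) at_top"
    if "R > 0" "\<epsilon> > 0" for R \<epsilon> :: real
  proof -
    obtain R' where R': "R' > 0" "\<And>y z. \<lbrakk>y \<in> M; z \<in> M; d y z \<le> R\<rbrakk> \<Longrightarrow> d' (p y) (p z) \<le> R'"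
      using bornologous[OF \<open>R > 0\<close>] by blast
    obtain \<beta> where \<beta>: "\<beta> \<in> X \<rightarrow> ell2 X" and norm: "\<And>x. x \<in> X \<Longrightarrow> ell2_norm X (\<beta> x) = 1"
      and close: "\<And>x y. \<lbrakk>x \<in> X; y \<in> X; d' x y \<le> R'\<rbrakk> \<Longrightarrow> ell2_norm X (\<lambda>w. \<beta> x w - \<beta> y w) \<le> \<epsilon>"
      and tail: "((\<lambda>S::real. SUP x\<in>X. ennreal (\<Sum>\<^sub>\<infinity>w\<in>X - X.mcball x S. (cmod (\<beta> x w))\<^sup>2))
        \<longlongrightarrow> 0) at_top"
      using emb[unfolded X.strongly_embeddable_def] \<open>R' > 0\<close> \<open>\<epsilon> > 0\<close> by meson
    \<comment> \<open>The value 0 off the disjoint union is the extension by zero that membership in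
      \<open>ell2\<close> demands.\<close>
    define \<xi> where "\<xi> = (\<lambda>z w. if w \<in> ?Y then \<beta> (p z) (f w) else 0)"
    have pX: "p z \<in> X" if "z \<in> M" for z
      using p that by auto
    have summable: "(\<lambda>w. (cmod (\<beta> x w))\<^sup>2) summable_on X" if "x \<in> X" for x
      using \<beta> that by (auto simp: ell2_def)
    have ell2: "\<xi> z \<in> ell2 ?Y" if "z \<in> M" for z
    proof -
      have "(\<lambda>w. (cmod (\<beta> (p z) (f w)))\<^sup>2) summable_on ?Y"
        using summable_on_reindex_bij_betw[OF f, of "\<lambda>w. (cmod (\<beta> (p z) w))\<^sup>2"]
          summable[OF pX[OF that]] by simp
      then have "(\<lambda>w. (cmod (\<xi> z w))\<^sup>2) summable_on ?Y"
        by (rule summable_on_cong[THEN iffD1, rotated]) (simp add: \<xi>_def)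
      then show ?thesis
        by (simp add: ell2_def \<xi>_def)
    qed
    \<comment> \<open>Reindexing along \<open>f\<close> is an isometry of the two sequence spaces.
      It is applied both to a single vector and to a difference of two.\<close>
    have norm_eq: "ell2_norm ?Y \<zeta> = ell2_norm X \<eta>" if "\<And>w. w \<in> ?Y \<Longrightarrow> \<zeta> w = \<eta> (f w)" for \<zeta> \<eta>
    proof -
      have "(\<Sum>\<^sub>\<infinity>w\<in>?Y. (cmod (\<zeta> w))\<^sup>2) = (\<Sum>\<^sub>\<infinity>w\<in>?Y. (cmod (\<eta> (f w)))\<^sup>2)"
        by (rule infsum_cong) (simp only: that)
      then show ?thesis
        unfolding ell2_norm_def
        using infsum_reindex_bij_betw[OF f, of "\<lambda>w. (cmod (\<eta> w))\<^sup>2"] by simp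
    qed
    have "ell2_norm ?Y (\<xi> z) = 1" if "z \<in> M" for z
      using norm_eq[of "\<xi> z" "\<beta> (p z)"] norm[OF pX[OF that]] by (simp add: \<xi>_def)
    moreover have "ell2_norm ?Y (\<lambda>w. \<xi> y w - \<xi> z w) \<le> \<epsilon>" if "y \<in> M" "z \<in> M" "d y z \<le> R" for y z
      using norm_eq[of "\<lambda>w. \<xi> y w - \<xi> z w" "\<lambda>w. \<beta> (p y) w - \<beta> (p z) w"]
        close[OF pX pX R'(2)] that by (simp add: \<xi>_def)
    moreover have "((\<lambda>S::real. SUP z\<in>M.
        ennreal (\<Sum>\<^sub>\<infinity>w\<in>?Y - (SIGMA i:{1..n}. \<phi> i ` M.mcball z S). (cmod (\<xi> z w))\<^sup>2))
        \<longlongrightarrow> 0) at_top" (is "(?t \<longlongrightarrow> 0) at_top")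
    \<comment> \<open>Nothing in \<open>ennreal\<close> lies below 0, so only the upper estimate has
      content.\<close>
    proof (rule order_tendstoI)
      fix e :: ennreal assume "0 < e"
      then obtain S where
        S: "(SUP x\<in>X. ennreal (\<Sum>\<^sub>\<infinity>w\<in>X - X.mcball x S. (cmod (\<beta> x w))\<^sup>2)) < e"
        using eventually_happens'[OF _ order_tendstoD(2)[OF tail]] trivial_limit_at_top_linorder
        by blast
      obtain T where T: "\<And>z w. \<lbrakk>z \<in> M; w \<in> ?Y; f w \<in> X.mcball (p z) S\<rbrakk>
          \<Longrightarrow> w \<in> (SIGMA i:{1..n}. \<phi> i ` M.mcball z T)"
        using cover[of S] by blast
      \<comment> \<open>One radius \<open>S\<close> suffices: the tails over \<open>z\<close> only
        shrink as \<open>T'\<close> grows past the \<open>T\<close> that \<open>cover\<close>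
        assigns to \<open>S\<close>.\<close>
      have "?t T' < e" if "T' \<ge> T" for T'
      proof -
        have "ennreal (\<Sum>\<^sub>\<infinity>w\<in>?Y - (SIGMA i:{1..n}. \<phi> i ` M.mcball z T'). (cmod (\<xi> z w))\<^sup>2)
            \<le> (SUP x\<in>X. ennreal (\<Sum>\<^sub>\<infinity>w\<in>X - X.mcball x S. (cmod (\<beta> x w))\<^sup>2))"
          if "z \<in> M" for z
        proof -
          let ?A = "?Y - (SIGMA i:{1..n}. \<phi> i ` M.mcball z T')"
          have "M.mcball z T \<subseteq> M.mcball z T'"
            using \<open>T' \<ge> T\<close> by auto
          \<comment> \<open>Contrapositive of \<open>T\<close>: an index outside the images of the
            ball about \<open>z\<close> is sent by \<open>f\<close> outside the ball about
            \<open>p z\<close>.\<close>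
          then have sub: "f ` ?A \<subseteq> X - X.mcball (p z) S"
            using T[OF \<open>z \<in> M\<close>] fX by fast
          have "bij_betw f ?A (f ` ?A)"
            using f by (meson Diff_subset bij_betw_subset)
          then have "(\<Sum>\<^sub>\<infinity>w\<in>?A. (cmod (\<beta> (p z) (f w)))\<^sup>2) = (\<Sum>\<^sub>\<infinity>w\<in>f ` ?A. (cmod (\<beta> (p z) w))\<^sup>2)"
            by (rule infsum_reindex_bij_betw)
          moreover have "(\<Sum>\<^sub>\<infinity>w\<in>?A. (cmod (\<xi> z w))\<^sup>2) = (\<Sum>\<^sub>\<infinity>w\<in>?A. (cmod (\<beta> (p z) (f w)))\<^sup>2)"
            by (rule infsum_cong) (simp add: \<xi>_def)
          moreover have "(\<Sum>\<^sub>\<infinity>w\<in>f ` ?A. (cmod (\<beta> (p z) w))\<^sup>2)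
              \<le> (\<Sum>\<^sub>\<infinity>w\<in>X - X.mcball (p z) S. (cmod (\<beta> (p z) w))\<^sup>2)"
          proof (rule infsum_mono2[OF _ _ sub])
            show "(\<lambda>w. (cmod (\<beta> (p z) w))\<^sup>2) summable_on f ` ?A"
              by (rule summable_on_subset_banach[OF summable[OF pX[OF \<open>z \<in> M\<close>]]]) (use sub in blast)
            show "(\<lambda>w. (cmod (\<beta> (p z) w))\<^sup>2) summable_on X - X.mcball (p z) S"
              by (rule summable_on_subset_banach[OF summable[OF pX[OF \<open>z \<in> M\<close>]]]) blast
          qed simp
          ultimately have "ennreal (\<Sum>\<^sub>\<infinity>w\<in>?A. (cmod (\<xi> z w))\<^sup>2)
              \<le> ennreal (\<Sum>\<^sub>\<infinity>w\<in>X - X.mcball (p z) S. (cmod (\<beta> (p z) w))\<^sup>2)"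
            by (intro ennreal_leI) simp
          also have "\<dots> \<le> (SUP x\<in>X. ennreal (\<Sum>\<^sub>\<infinity>w\<in>X - X.mcball x S. (cmod (\<beta> x w))\<^sup>2))"
            by (rule SUP_upper[OF pX[OF \<open>z \<in> M\<close>]])
          finally show ?thesis .
        qed
        \<comment> \<open>The bound is the same for all \<open>z\<close>, so the supremum over
          \<open>z\<close> stays strictly below \<open>e\<close>.\<close>
        then show ?thesis
          using S by (meson SUP_least le_less_trans)
      qed
      then show "eventually (\<lambda>T'. ?t T' < e) at_top"
        by (auto simp: eventually_at_top_linorder)
    qed simp
    ultimately show ?thesis
      using ell2 by (intro exI[of _ \<xi>]) blast
  qed
  then show ?thesis
    unfolding M.strongly_embeddable_family_def using \<phi> by blast
qed

section \<open>Orbits as coset spaces of stabilizers\<close>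

context group_action
begin

text \<open>Orbit-stabilizer correspondence: \<open>a\<close> and \<open>g\<close> move
  \<open>x\<close> to the same point exactly when \<open>inv g \<otimes> a\<close> fixes
  \<open>x\<close>.\<close>

lemma mem_l_coset_stabilizer_iff:
  assumes "x \<in> E" "g \<in> carrier G"
  shows "a \<in> g <# stabilizer G \<phi> x \<longleftrightarrow> a \<in> carrier G \<and> \<phi> a x = \<phi> g x"
proof -
  interpret group G
    using group_hom group_hom.axioms(1) by auto
  show ?thesis
  proof
    assume "a \<in> g <# stabilizer G \<phi> x"
    then show "a \<in> carrier G \<and> \<phi> a x = \<phi> g x"
      using assms by (auto simp: l_coset_def stabilizer_def composition_rule)
  next
    assume a: "a \<in> carrier G \<and> \<phi> a x = \<phi> g x"
    then have "\<phi> (inv g \<otimes> a) x = x"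
      using assms composition_rule[of x "inv g" a] orbit_sym_aux[of g x] by simp
    moreover have "a = g \<otimes> (inv g \<otimes> a)"
      using a assms by (simp add: m_assoc[symmetric])
    ultimately show "a \<in> g <# stabilizer G \<phi> x"
      using a assms unfolding l_coset_def stabilizer_def by blast
  qed
qed

lemma l_coset_stabilizer_eq_iff:
  assumes "x \<in> E" "g \<in> carrier G" "h \<in> carrier G"
  shows "g <# stabilizer G \<phi> x = h <# stabilizer G \<phi> x \<longleftrightarrow> \<phi> g x = \<phi> h x"
  using assms by (auto simp: mem_l_coset_stabilizer_iff set_eq_iff)

text \<open>Makes evaluation at \<open>x\<close> well defined on cosets given as sets: the
  representative picked by \<open>SOME\<close> does not affect the value.\<close>

lemma some_l_coset_stabilizer:
  assumes "x \<in> E" "g \<in> carrier G"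
  shows "\<phi> (SOME a. a \<in> g <# stabilizer G \<phi> x) x = \<phi> g x"
  using someI[of "\<lambda>a. a \<in> g <# stabilizer G \<phi> x" g] assms
  by (simp add: mem_l_coset_stabilizer_iff)

lemma orbit_representative:
  assumes "bij_betw (\<lambda>i. orbit G \<phi> (x i)) I (orbits G E \<phi>)" "y \<in> E"
  shows "\<exists>i\<in>I. \<exists>g\<in>carrier G. y = \<phi> g (x i)"
proof -
  have "orbit G \<phi> y \<in> orbits G E \<phi>"
    using assms by (auto simp: orbits_def)
  then obtain i where "i \<in> I" "orbit G \<phi> y = orbit G \<phi> (x i)"
    using assms by (auto simp: bij_betw_def)
  then show ?thesis
    using orbit_refl[OF assms(2)] by (auto simp: orbit_def)
qed

text \<open>The orbits partition \<open>E\<close>, each is represented by exactly one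
  \<open>x i\<close>, and within an orbit a coset is determined by where it sends
  \<open>x i\<close>.\<close>

lemma bij_betw_lcosets_stabilizers:
  assumes x: "\<And>i. i \<in> I \<Longrightarrow> x i \<in> E"
    and bij: "bij_betw (\<lambda>i. orbit G \<phi> (x i)) I (orbits G E \<phi>)"
  shows "bij_betw (\<lambda>(i, C). \<phi> (SOME a. a \<in> C) (x i))
    (SIGMA i:I. lcosets (stabilizer G \<phi> (x i))) E"
proof (rule bij_betw_imageI)
  show "inj_on (\<lambda>(i, C). \<phi> (SOME a. a \<in> C) (x i)) (SIGMA i:I. lcosets (stabilizer G \<phi> (x i)))"
  proof (rule inj_onI, clarify)
    fix i C j D
    assume i: "i \<in> I" "C \<in> lcosets (stabilizer G \<phi> (x i))"
      and j: "j \<in> I" "D \<in> lcosets (stabilizer G \<phi> (x j))"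
      and eq: "\<phi> (SOME a. a \<in> C) (x i) = \<phi> (SOME a. a \<in> D) (x j)"
    obtain g where g: "g \<in> carrier G" "C = g <# stabilizer G \<phi> (x i)"
      using i by (auto simp: LCOSETS_def)
    obtain h where h: "h \<in> carrier G" "D = h <# stabilizer G \<phi> (x j)"
      using j by (auto simp: LCOSETS_def)
    have gh: "\<phi> g (x i) = \<phi> h (x j)"
      using eq g h x i j by (simp add: some_l_coset_stabilizer)
    \<comment> \<open>A common point of two orbits forces them to coincide; injectivity of the
      indexing then gives \<open>i = j\<close>.\<close>
    have "\<phi> g (x i) \<in> orbit G \<phi> (x i) \<inter> orbit G \<phi> (x j)"
      using g(1) h(1) gh unfolding orbit_def by blast
    moreover have "orbit G \<phi> (x i) \<in> orbits G E \<phi>" "orbit G \<phi> (x j) \<in> orbits G E \<phi>"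
      using x i j by (auto simp: orbits_def)
    ultimately have "orbit G \<phi> (x i) = orbit G \<phi> (x j)"
      using disjoint_union by blast
    then have "i = j"
      using bij i j by (auto simp: bij_betw_def dest: inj_onD)
    then show "i = j \<and> C = D"
      using gh g h x i l_coset_stabilizer_eq_iff by simp
  qed
  have "y \<in> (\<lambda>(i, C). \<phi> (SOME a. a \<in> C) (x i)) ` (SIGMA i:I. lcosets (stabilizer G \<phi> (x i)))"
    if "y \<in> E" for y
  proof -
    obtain i g where "i \<in> I" "g \<in> carrier G" "y = \<phi> g (x i)"
      using orbit_representative[OF bij \<open>y \<in> E\<close>] by blast
    then show ?thesis
      using x by (intro image_eqI[of _ _ "(i, g <# stabilizer G \<phi> (x i))"])
        (auto simp: some_l_coset_stabilizer LCOSETS_def)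
  qed
  moreover have "\<phi> (SOME a. a \<in> C) (x i) \<in> E"
    if "i \<in> I" "C \<in> lcosets (stabilizer G \<phi> (x i))" for i C
    using that(2) x[OF that(1)] element_image
    by (auto simp: LCOSETS_def some_l_coset_stabilizer)
  ultimately show "(\<lambda>(i, C). \<phi> (SOME a. a \<in> C) (x i)) `
      (SIGMA i:I. lcosets (stabilizer G \<phi> (x i))) = E"
    by auto
qed

end

section \<open>The orbit map of a base point satisfies the pullback hypotheses\<close>

theorem theorem4p12:
  fixes G :: "('g, 'm) monoid_scheme"
    and d\<^sub>G :: "'g \<Rightarrow> 'g \<Rightarrow> real"
    and X :: "'x set"
    and d\<^sub>X :: "'x \<Rightarrow> 'x \<Rightarrow> real"
    and \<phi> :: "'g \<Rightarrow> 'x \<Rightarrow> 'x"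
    and n :: nat
    and x :: "nat \<Rightarrow> 'x"
  assumes "group G"
    and "countable (carrier G)"
    and "Metric_space (carrier G) d\<^sub>G"
    and "Metric_space.uniformly_discrete (carrier G) d\<^sub>G"
    and "Metric_space.proper_metric (carrier G) d\<^sub>G"
    and "left_invariant G d\<^sub>G"
    and "X \<noteq> {}"
    and "Metric_space X d\<^sub>X"
    and "Metric_space.strongly_embeddable X d\<^sub>X"
    and "Metric_space.uniformly_discrete X d\<^sub>X"
    and "Metric_space.bounded_geometry X d\<^sub>X"
    and "isometric_action G X d\<^sub>X \<phi>"
    and "finite (orbits G X \<phi>)"
    and "\<forall>i\<in>{1..n}. x i \<in> X"
    and "bij_betw (\<lambda>i. orbit G \<phi> (x i)) {1..n} (orbits G X \<phi>)"
  shows "Metric_space.strongly_embeddable_family (carrier G) d\<^sub>G n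
    (\<lambda>i. lcosets\<^bsub>G\<^esub> (stabilizer G \<phi> (x i)))
    (\<lambda>i g. g <#\<^bsub>G\<^esub> stabilizer G \<phi> (x i))"
proof -
  interpret group G by fact
  interpret G: Metric_space "carrier G" d\<^sub>G by fact
  interpret X: Metric_space X d\<^sub>X by fact
  interpret group_action G X \<phi>
    using assms(12) by (simp add: isometric_action_def)
  have isometry: "d\<^sub>X (\<phi> g y) (\<phi> g z) = d\<^sub>X y z" if "g \<in> carrier G" "y \<in> X" "z \<in> X" for g y z
    using assms(12) that by (simp add: isometric_action_def)
  have invariant: "d\<^sub>G (g \<otimes>\<^bsub>G\<^esub> h) (g \<otimes>\<^bsub>G\<^esub> k) = d\<^sub>G h k"
    if "g \<in> carrier G" "h \<in> carrier G" "k \<in> carrier G" for g h k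
    using assms(6) that by (simp add: left_invariant_def)
  have xX: "x i \<in> X" if "i \<in> {1..n}" for i
    using assms(14) that by blast
  let ?f = "\<lambda>(i, C). \<phi> (SOME a. a \<in> C) (x i)"
  let ?Y = "SIGMA i:{1..n}. lcosets\<^bsub>G\<^esub> (stabilizer G \<phi> (x i))"
  have bij: "bij_betw ?f ?Y X"
    by (rule bij_betw_lcosets_stabilizers[OF xX assms(15)])
  obtain x\<^sub>0 where x\<^sub>0: "x\<^sub>0 \<in> X"
    using assms(7) by blast
  have img: "\<phi> g y \<in> X" if "g \<in> carrier G" "y \<in> X" for g y
    using element_image that by blast
  \<comment> \<open>The summand 1 keeps the bound positive even for empty \<open>A\<close>. The fact
    serves both for balls in \<open>G\<close> and for balls in \<open>X\<close>.\<close>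
  have bound: "\<exists>b>0. \<forall>a\<in>A. h a \<le> b" if "finite A" for A and h :: "'c \<Rightarrow> real"
  proof (intro exI conjI ballI)
    show "0 < 1 + (\<Sum>a\<in>A. \<bar>h a\<bar>)"
      by (simp add: add_pos_nonneg sum_nonneg)
    show "h a \<le> 1 + (\<Sum>a\<in>A. \<bar>h a\<bar>)" if "a \<in> A" for a
      using member_le_sum[of a A "\<lambda>a. \<bar>h a\<bar>"] that \<open>finite A\<close> by simp
  qed
  show ?thesis
  proof (rule strongly_embeddable_family_pullback[where p = "\<lambda>g. \<phi> g x\<^sub>0"])
    fix R :: real
    \<comment> \<open>\<open>R'\<close> bounds the displacement of \<open>x\<^sub>0\<close> by the
      finitely many elements within \<open>R\<close> of the identity. Left invariance and isometry
      reduce any pair \<open>g\<close>, \<open>h\<close> to the identity and \<open>a\<close>, the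
      quotient of \<open>h\<close> by \<open>g\<close>.\<close>
    have "finite (G.mcball \<one>\<^bsub>G\<^esub> R)"
      using assms(5) by (simp add: G.proper_metric_def)
    from bound[OF this] obtain R' where "R' > 0"
      and R': "\<And>a. a \<in> G.mcball \<one>\<^bsub>G\<^esub> R \<Longrightarrow> d\<^sub>X x\<^sub>0 (\<phi> a x\<^sub>0) \<le> R'"
      by meson
    have "d\<^sub>X (\<phi> g x\<^sub>0) (\<phi> h x\<^sub>0) \<le> R'" if "g \<in> carrier G" "h \<in> carrier G" "d\<^sub>G g h \<le> R" for g h
    proof -
      define a where "a = inv\<^bsub>G\<^esub> g \<otimes>\<^bsub>G\<^esub> h"
      have a: "a \<in> carrier G" "h = g \<otimes>\<^bsub>G\<^esub> a"
        using that by (auto simp: a_def m_assoc[symmetric])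
      have "d\<^sub>G \<one>\<^bsub>G\<^esub> a = d\<^sub>G g h"
        using invariant[of g "\<one>\<^bsub>G\<^esub>" a] a that by simp
      then have "a \<in> G.mcball \<one>\<^bsub>G\<^esub> R"
        using a that by simp
      moreover have "d\<^sub>X (\<phi> g x\<^sub>0) (\<phi> h x\<^sub>0) = d\<^sub>X x\<^sub>0 (\<phi> a x\<^sub>0)"
        using a that x\<^sub>0 by (simp add: composition_rule isometry img)
      ultimately show ?thesis
        using R' by simp
    qed
    then show "\<exists>R'>0. \<forall>g\<in>carrier G. \<forall>h\<in>carrier G.
        d\<^sub>G g h \<le> R \<longrightarrow> d\<^sub>X (\<phi> g x\<^sub>0) (\<phi> h x\<^sub>0) \<le> R'"
      using \<open>R' > 0\<close> by blast
  next
    fix S :: real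
    \<comment> \<open>Bounded geometry speaks of positive radii only, while \<open>cover\<close>
      asks for every real \<open>S\<close>; hence the maximum with 1.\<close>
    have "finite (X.mcball x\<^sub>0 (max S 1))"
      using assms(11) x\<^sub>0 unfolding X.bounded_geometry_def
      by (meson less_max_iff_disj zero_less_one)
    moreover have "X.mcball x\<^sub>0 S \<subseteq> X.mcball x\<^sub>0 (max S 1)"
      by auto
    ultimately have fin: "finite (X.mcball x\<^sub>0 S)"
      by (rule rev_finite_subset)
    \<comment> \<open>Fix for every point of \<open>X\<close> one way of writing it as a translate
      of a representative; \<open>T\<close> then bounds the translating elements over the finite
      ball about \<open>x\<^sub>0\<close>.\<close>
    obtain k h where kh: "\<And>y. y \<in> X \<Longrightarrow> k y \<in> {1..n} \<and> h y \<in> carrier G \<and> y = \<phi> (h y) (x (k y))"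
      using orbit_representative[OF assms(15)] by metis
    from bound[OF fin] obtain T where
      T: "\<And>y. y \<in> X.mcball x\<^sub>0 S \<Longrightarrow> d\<^sub>G \<one>\<^bsub>G\<^esub> (h y) \<le> T"
      by meson
    have "w \<in> (SIGMA i:{1..n}. (\<lambda>g. g <#\<^bsub>G\<^esub> stabilizer G \<phi> (x i)) ` G.mcball g T)"
      if g: "g \<in> carrier G" and w: "w \<in> ?Y" and ball: "?f w \<in> X.mcball (\<phi> g x\<^sub>0) S" for g w
    proof -
      \<comment> \<open>Translating back by the inverse of \<open>g\<close> moves the ball about
        \<open>\<phi> g x\<^sub>0\<close> to the one about \<open>x\<^sub>0\<close>, where
        \<open>T\<close> applies.\<close>
      define y where "y = \<phi> (inv\<^bsub>G\<^esub> g) (?f w)"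
      have fw: "?f w \<in> X"
        using ball by simp
      have y: "y \<in> X" "\<phi> g y = ?f w"
        using fw g img orbit_sym_aux[of "inv\<^bsub>G\<^esub> g" "?f w" y] by (simp_all add: y_def)
      have "y \<in> X.mcball x\<^sub>0 S"
        using ball isometry[OF g x\<^sub>0 y(1)] y x\<^sub>0 by simp
      then have "d\<^sub>G \<one>\<^bsub>G\<^esub> (h y) \<le> T"
        by (rule T)
      then have gh: "g \<otimes>\<^bsub>G\<^esub> h y \<in> G.mcball g T"
        using invariant[of g "\<one>\<^bsub>G\<^esub>" "h y"] g kh[OF y(1)] by simp
      \<comment> \<open>By construction \<open>v\<close> is the coset of an element within
        \<open>T\<close> of \<open>g\<close>. Since \<open>v\<close> and \<open>w\<close> have the
        same image under the bijection, they are equal.\<close>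
      define v where "v = (k y, (g \<otimes>\<^bsub>G\<^esub> h y) <#\<^bsub>G\<^esub> stabilizer G \<phi> (x (k y)))"
      have v: "v \<in> ?Y"
        using kh[OF y(1)] g by (auto simp: v_def LCOSETS_def)
      have "?f v = \<phi> (g \<otimes>\<^bsub>G\<^esub> h y) (x (k y))"
        using kh[OF y(1)] g xX by (simp add: v_def some_l_coset_stabilizer)
      also have "\<dots> = \<phi> g y"
        using kh[OF y(1)] g xX composition_rule by metis
      finally have "?f v = ?f w"
        using y by simp
      then have "v = w"
        using bij v w by (meson bij_betw_def inj_onD)
      then show ?thesis
        using gh kh[OF y(1)] by (auto simp: v_def)
    qed
    then show "\<exists>T. \<forall>g\<in>carrier G. \<forall>w\<in>?Y. ?f w \<in> X.mcball (\<phi> g x\<^sub>0) S \<longrightarrow>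
        w \<in> (SIGMA i:{1..n}. (\<lambda>g. g <#\<^bsub>G\<^esub> stabilizer G \<phi> (x i)) ` G.mcball g T)"
      by blast
  qed (use assms(3,8,9) bij x\<^sub>0 img in \<open>auto simp: LCOSETS_def\<close>)
qed

end
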